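(* Let $X$ be a real Banach space and let $T:X\rightrightarrows X^*$ be a point-to-set operator (i.e. $T\subset X\times X^*$). The following conditions are equivalent: 1. $T$ is maximal monotone and there exists some $h\in\mathcal F_T$ such that $h^*(x^*,x^{**})\ge\langle x^*,x^{**}\rangle$ for all $(x^*,x^{**})\in X^*\times X^{**}$ (and $h(x,x^* )\ge\langle x,x^*\rangle$ for all $(x,x^* )\in X\times X^*$). 2. $T$ is maximal monotone and every $h\in\mathcal F_T$ satisfies $h^*(x^*,x^{**})\ge\langle x^*,x^{**}\rangle$ for all $(x^*,x^{**})\in X^*\times X^{**}$ (and $h(x,x^* )\ge\langle x,x^*\rangle$ for all $(x,x^* )\in X\times X^*$). 3. $T$ is maximal monotone and some $h\in\mathcal F_T$ satisfies $$\inf_{(x,x^* )\in X\times X^*}\Big( h_{(x_0,x_0^* )}(x,x^* )+\tfrac12\|x\|^2+\tfrac12\|x^*\|^2\Big)=0\qquad\forall (x_0,x_0^* )\in X\times X^*.$$ 4. $T$ is maximal monotone and every $h\in\mathcal F_T$ satisfies $$\inf_{(x,x^* )\in X\times X^*}\Big( h_{(x_0,x_0^* )}(x,x^* )+\tfrac12\|x\|^2+\tfrac12\|x^*\|^2\Big)=0\qquad\forall (x_0,x_0^* )\in X\times X^*.$$ 5. $T$ is of type (NI), that is, $T$ is maximal monotone and $$\inf_{(y,y^* )\in T}\langle x^{**}-y,\,x^*-y^*\rangle\le 0\qquad\forall (x^*,x^{**})\in X^*\times X^{**}.$$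
   Context: $X^*$ and $X^{**}$ denote the topological dual and bidual of the real Banach space $X$ (not assumed reflexive), with their usual dual norms. $X$ is identified with its image under the canonical injection into $X^{**}$. The duality products are $\langle x,x^*\rangle=x^*(x)$ on $X\times X^*$ and $\langle x^*,x^{**}\rangle=x^{**}(x^* )$ on $X^*\times X^{**}$; the order of the arguments is immaterial, so $\langle x^{**}-y,x^*-y^*\rangle$ means $(x^{**}-y)(x^*-y^* )$ with $y$ regarded as an element of $X^{**}$. An operator $T\subset X\times X^*$ is monotone if $\langle x-y,x^*-y^*\rangle\ge0$ for all $(x,x^* ),(y,y^* )\in T$; it is maximal monotone if it is monotone and maximal with respect to inclusion among monotone subsets of $X\times X^*$. For a maximal monotone $T$, the Fitzpatrick family $\mathcal F_T$ is the set of all functions $h:X\times X^*\to[-\infty,+\infty]$ such that: $h$ is convex and lower semicontinuous (in the norm topology of $X\times X^*$); $h(x,x^* )\ge\langle x,x^*\rangle$ for all $(x,x^* )\in X\times X^*$; and $h(x,x^* )=\langle x,x^*\rangle$ whenever $(x,x^* )\in T$. For $h:X\times X^*\to[-\infty,+\infty]$, the conjugate is $h^*:X^*\times X^{**}\to[-\infty,+\infty]$ (identifying $(X\times X^* )^*$ with $X^*\times X^{**}$), $$h^*(x^*,x^{**})=\sup_{(y,y^* )\in X\times X^*}\ \langle y,x^*\rangle+\langle y^*,x^{**}\rangle-h(y,y^* ).$$ For $(x_0,x_0^* )\in X\times X^*$, the function $h_{(x_0,x_0^* )}:X\times X^*\to[-\infty,+\infty]$ is defined by $$h_{(x_0,x_0^*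 )}(x,x^* )=h(x+x_0,x^*+x_0^* )-\big[\langle x,x_0^*\rangle+\langle x_0,x^*\rangle+\langle x_0,x_0^*\rangle\big].$$ *)

theory Defs
  imports "HOL-Analysis.Analysis"
begin

type_synonym 'a dual = "'a \<Rightarrow>\<^sub>L real"
type_synonym 'a bidual = "'a dual \<Rightarrow>\<^sub>L real"

definition canonical_injection :: "'a::real_normed_vector \<Rightarrow> 'a bidual"
  where "canonical_injection x = Blinfun (\<lambda>x'. blinfun_apply x' x)"

lemma canonical_injection_apply [simp]:
  "blinfun_apply (canonical_injection x) x' = blinfun_apply x' x"
  by (simp add: canonical_injection_def bounded_linear_Blinfun_apply blinfun.bounded_linear_left)

definition monotone_operator :: "('a::real_normed_vector \<times> 'a dual) set \<Rightarrow> bool"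
  where "monotone_operator T \<longleftrightarrow>
    (\<forall>(x, x') \<in> T. \<forall>(y, y') \<in> T. 0 \<le> blinfun_apply (x' - y') (x - y))"

definition maximal_monotone :: "('a::real_normed_vector \<times> 'a dual) set \<Rightarrow> bool"
  where "maximal_monotone T \<longleftrightarrow>
    monotone_operator T \<and> (\<forall>S. monotone_operator S \<and> T \<subseteq> S \<longrightarrow> S = T)"

text \<open>Convexity of an extended-real-valued function is convexity of its epigraph, taken
  in the product of the space with the reals; this avoids the indeterminate
  sum of the two infinities.\<close>

definition ereal_convex :: "('b::real_vector \<Rightarrow> ereal) \<Rightarrow> bool"
  where "ereal_convex f \<longleftrightarrow> convex {(z, r :: real). f z \<le> ereal r}"

definition lower_semicontinuous :: "('b::topological_space \<Rightarrow> ereal) \<Rightarrow> bool"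
  where "lower_semicontinuous f \<longleftrightarrow> (\<forall>z. f z \<le> Liminf (at z) f)"

definition fitzpatrick_family ::
    "('a::real_normed_vector \<times> 'a dual) set \<Rightarrow> ('a \<times> 'a dual \<Rightarrow> ereal) set"
  where "fitzpatrick_family T = {h.
    ereal_convex h \<and> lower_semicontinuous h \<and>
    (\<forall>x x'. ereal (blinfun_apply x' x) \<le> h (x, x')) \<and>
    (\<forall>(x, x') \<in> T. h (x, x') = ereal (blinfun_apply x' x))}"

definition conjugate ::
    "('a::real_normed_vector \<times> 'a dual \<Rightarrow> ereal) \<Rightarrow> 'a dual \<times> 'a bidual \<Rightarrow> ereal"
  where "conjugate h = (\<lambda>(x', x'').
    SUP (y, y'). ereal (blinfun_apply x' y + blinfun_apply x'' y') - h (y, y'))"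

definition translate ::
    "('a::real_normed_vector \<times> 'a dual \<Rightarrow> ereal) \<Rightarrow> 'a \<times> 'a dual \<Rightarrow> 'a \<times> 'a dual \<Rightarrow> ereal"
  where "translate h = (\<lambda>(x\<^sub>0, x\<^sub>0') (x, x').
    h (x + x\<^sub>0, x' + x\<^sub>0') -
    ereal (blinfun_apply x\<^sub>0' x + blinfun_apply x' x\<^sub>0 + blinfun_apply x\<^sub>0' x\<^sub>0))"

definition type_NI :: "('a::real_normed_vector \<times> 'a dual) set \<Rightarrow> bool"
  where "type_NI T \<longleftrightarrow> maximal_monotone T \<and>
    (\<forall>x' x''. (INF (y, y') \<in> T.
      ereal (blinfun_apply (x'' - canonical_injection y) (x' - y'))) \<le> 0)"

end

theory Submission
  imports Defs
begin

text \<open>Conditions 1 and 2 pass to 3 and 4 for the same h: translate h by z0 and apply Fenchel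
  duality to its sum with half the squared norm, whose infimum is nonnegative because
  h dominates the duality product. A positive infimum m would give a pair (u, v) in
  X* \<times> X** at which -m dominates h*(x0* - u, x0 - v), suitably translated, plus
  half the squared norms of u and v, contradicting the lower bound on h*.

  Condition 3 implies (NI): iterating the infimum condition from a point where h exceeds the
  duality product by less than s^2 moves by at most 3s, 3s/2, 3s/4, ..., and the limit lies in T
  by lower semicontinuity. Hence the near-minimisers of the infimum condition at z0 can be
  replaced by points of T. For a given (x*, x**) take z0 = (0, x* + w), where w in X* nearly
  satisfies <w, x**> = |w|^2 = |x**|^2; the resulting points (y, y*) of T make
  <x** - y, x* - y*> at most arbitrarily small.

  Finally (NI) says that the conjugate of the restriction of the duality product to T dominates
  the duality product on X* \<times> X**, and this conjugate is a minorant of h* for every h in the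
  family. The family is nonempty, as it contains the Fitzpatrick function of T.\<close>

section \<open>Hahn--Banach and Fenchel duality\<close>

text \<open>Homogeneity is asked for positive factors only; \<open>c = 2\<close> at the origin then
  forces the value 0 there.\<close>

definition sublinear :: "('v::real_vector \<Rightarrow> real) \<Rightarrow> bool"
  where "sublinear p \<longleftrightarrow> (\<forall>x y. p (x + y) \<le> p x + p y) \<and> (\<forall>c>0. \<forall>x. p (c *\<^sub>R x) = c * p x)"

lemma sublinear_add: "sublinear p \<Longrightarrow> p (x + y) \<le> p x + p y"
  and sublinear_scale: "sublinear p \<Longrightarrow> 0 < c \<Longrightarrow> p (c *\<^sub>R x) = c * p x"
  by (auto simp: sublinear_def)

lemma sublinear_zero: "sublinear p \<Longrightarrow> p 0 = 0"
  using sublinear_scale[of p 2 0] by simp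

lemma sublinear_neg: "sublinear p \<Longrightarrow> - p (- x) \<le> p x"
  using sublinear_add[of p x "- x"] sublinear_zero[of p] by simp

lemma cINF_scale_pos:
  fixes f :: "'i \<Rightarrow> real"
  assumes "I \<noteq> {}" "bdd_below (f ` I)" "0 < c"
  shows "(INF i\<in>I. c * f i) = c * (INF i\<in>I. f i)"
proof (rule antisym)
  obtain l where l: "\<And>i. i \<in> I \<Longrightarrow> l \<le> f i"
    using assms(2) by (auto simp: bdd_below_def)
  have bdd: "bdd_below ((\<lambda>i. c * f i) ` I)"
    using l assms(3) by (intro bdd_belowI2[where m = "c * l"]) simp
  have "(INF i\<in>I. c * f i) / c \<le> (INF i\<in>I. f i)"
    using assms cINF_lower[OF bdd]
    by (intro cINF_greatest) (auto simp: field_simps)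
  then show "(INF i\<in>I. c * f i) \<le> c * (INF i\<in>I. f i)"
    using assms(3) by (simp add: field_simps)
  show "c * (INF i\<in>I. f i) \<le> (INF i\<in>I. c * f i)"
    using assms cINF_lower[OF assms(2)] by (intro cINF_greatest) auto
qed

text \<open>The lower bound that Zorn's lemma requires of a chain. Each member is at least
  \<open>- p (- x)\<close> at \<open>x\<close>, so the pointwise infimum is finite; it is
  subadditive because the smaller of two members can serve for both summands.\<close>

lemma sublinear_chain_bound:
  assumes ne: "C \<noteq> {}"
    and sub: "\<And>q. q \<in> C \<Longrightarrow> sublinear q \<and> (\<forall>x. q x \<le> p x)"
    and chain: "\<And>q r. q \<in> C \<Longrightarrow> r \<in> C \<Longrightarrow> q \<le> r \<or> r \<le> q"
  shows "sublinear (\<lambda>x. INF q\<in>C. q x)" and "\<And>q x. q \<in> C \<Longrightarrow> (INF q\<in>C. q x) \<le> q x"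
proof -
  have bdd: "bdd_below ((\<lambda>q. q x) ` C)" for x
  proof (rule bdd_belowI2)
    fix q assume q: "q \<in> C"
    show "- p (- x) \<le> q x"
      using sublinear_neg[of q x] sub[OF q] by (smt (verit))
  qed
  show low: "(INF q\<in>C. q x) \<le> q x" if "q \<in> C" for q x
    using bdd that by (rule cINF_lower)
  show "sublinear (\<lambda>x. INF q\<in>C. q x)"
    unfolding sublinear_def
  proof (intro conjI allI impI)
    fix x y
    have *: "(INF q\<in>C. q (x + y)) \<le> q x + r y" if qr: "q \<in> C" "r \<in> C" for q r
      using chain[OF qr]
    proof
      assume "q \<le> r"
      then show ?thesis
        using low[OF qr(1), of "x + y"] sublinear_add[of q x y] sub[OF qr(1)] le_funD[of q r y]
        by linarith
    next
      assume "r \<le> q"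
      then show ?thesis
        using low[OF qr(2), of "x + y"] sublinear_add[of r x y] sub[OF qr(2)] le_funD[of r q x]
        by linarith
    qed
    have "(INF q\<in>C. q (x + y)) - r y \<le> (INF q\<in>C. q x)" if "r \<in> C" for r
      using * that ne by (intro cINF_greatest) (auto simp: algebra_simps)
    then have "(INF q\<in>C. q (x + y)) - (INF q\<in>C. q x) \<le> (INF q\<in>C. q y)"
      using ne by (intro cINF_greatest) (auto simp: algebra_simps)
    then show "(INF q\<in>C. q (x + y)) \<le> (INF q\<in>C. q x) + (INF q\<in>C. q y)"
      by simp
  next
    fix c :: real and x assume c: "0 < c"
    have "(INF q\<in>C. q (c *\<^sub>R x)) = (INF q\<in>C. c * q x)"
      using sub sublinear_scale[OF _ c] by (intro INF_cong) auto
    then show "(INF q\<in>C. q (c *\<^sub>R x)) = c * (INF q\<in>C. q x)"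
      using cINF_scale_pos[OF ne bdd c] by simp
  qed
qed

text \<open>Step length 0 gives \<open>r x \<le> q x\<close> and step length 1 gives
  \<open>r x + q a \<le> q (x + a)\<close>, so a \<open>q\<close> that cannot be lowered is
  superadditive. Subadditivity of \<open>r\<close> comes from adding step lengths, and
  \<open>- q (- x)\<close> bounds the infimum from below.\<close>

lemma sublinear_directional_inf:
  fixes a :: "'v::real_vector"
  assumes q: "sublinear q"
  defines "r \<equiv> \<lambda>x. INF t\<in>{0..}. q (x + t *\<^sub>R a) - t * q a"
  shows "sublinear r" and "\<And>x t. 0 \<le> t \<Longrightarrow> r x \<le> q (x + t *\<^sub>R a) - t * q a"
proof -
  have scale0: "q (t *\<^sub>R x) = t * q x" if "0 \<le> t" for t x
    using that sublinear_scale[OF q, of t x] sublinear_zero[OF q] by (cases "t = 0") auto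
  have bdd: "bdd_below ((\<lambda>t. q (x + t *\<^sub>R a) - t * q a) ` {0..})" for x
  proof (rule bdd_belowI2)
    fix t :: real assume "t \<in> {0..}"
    then show "- q (- x) \<le> q (x + t *\<^sub>R a) - t * q a"
      using sublinear_add[OF q, of "x + t *\<^sub>R a" "- x"] scale0[of t a] by simp
  qed
  show low: "r x \<le> q (x + t *\<^sub>R a) - t * q a" if "0 \<le> t" for x t
    unfolding r_def using bdd that by (intro cINF_lower) auto
  show "sublinear r"
    unfolding sublinear_def
  proof (intro conjI allI impI)
    fix x y
    have *: "r (x + y) \<le> (q (x + s *\<^sub>R a) - s * q a) + (q (y + t *\<^sub>R a) - t * q a)"
      if "0 \<le> s" "0 \<le> t" for s t
      using low[of "s + t" "x + y"] that
        sublinear_add[OF q, of "x + s *\<^sub>R a" "y + t *\<^sub>R a"]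
      by (simp add: algebra_simps)
    have "r (x + y) - (q (y + t *\<^sub>R a) - t * q a) \<le> r x" if "0 \<le> t" for t
      unfolding r_def[of] using * that by (intro cINF_greatest) (auto simp: algebra_simps r_def)
    then have "r (x + y) - r x \<le> (INF t\<in>{0..}. q (y + t *\<^sub>R a) - t * q a)"
      by (intro cINF_greatest) (auto simp: algebra_simps)
    then show "r (x + y) \<le> r x + r y"
      by (simp add: r_def)
  next
    fix c :: real and x assume c: "0 < c"
    have eq: "c * (q (x + t *\<^sub>R a) - t * q a) = q (c *\<^sub>R x + (c * t) *\<^sub>R a) - (c * t) * q a" for t
      using sublinear_scale[OF q c, of "x + t *\<^sub>R a"] by (simp add: algebra_simps)
    have im: "(*) c ` {0..} = {0..}"
    proof (intro equalityI subsetI)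
      fix t :: real assume "t \<in> {0..}"
      then show "t \<in> (*) c ` {0..}"
        using c by (intro image_eqI[of _ _ "t / c"]) auto
    qed (use c in auto)
    have "c * r x = (INF t\<in>{0..}. c * (q (x + t *\<^sub>R a) - t * q a))"
      unfolding r_def by (rule cINF_scale_pos[OF _ bdd c, symmetric]) auto
    also have "\<dots> = (INF t\<in>(*) c ` {0..}. q (c *\<^sub>R x + t *\<^sub>R a) - t * q a)"
      unfolding image_image eq ..
    finally show "r (c *\<^sub>R x) = c * r x"
      unfolding im r_def by simp
  qed
qed

text \<open>A pointwise minimal sublinear functional is additive, since it coincides with its
  directional infimum along every vector.\<close>

lemma sublinear_dominates_linear:
  fixes p :: "'v::real_vector \<Rightarrow> real"
  assumes p: "sublinear p"
  obtains f where "linear f" "\<And>x. f x \<le> p x"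
proof -
  define A where "A = {q. sublinear q \<and> (\<forall>x. q x \<le> p x)}"
  \<comment> \<open>The order is reversed, so that maximality in Zorn's lemma means pointwise
    minimality.\<close>
  define R where "R = relation_of (\<lambda>q r. r \<le> q) A"
  have po: "partial_order_on A R"
    unfolding R_def by (rule partial_order_on_relation_ofI) auto
  have ub: "\<exists>u\<in>A. \<forall>a\<in>C. u \<le> a" if C: "C \<in> Chains R" for C
  proof (cases "C = {}")
    case True
    then show ?thesis using p by (auto simp: A_def)
  next
    case False
    have CA: "C \<subseteq> A" and chain: "\<And>q r. q \<in> C \<Longrightarrow> r \<in> C \<Longrightarrow> q \<le> r \<or> r \<le> q"
      using C by (auto simp: Chains_def R_def relation_of_def)
    have sub: "\<And>q. q \<in> C \<Longrightarrow> sublinear q \<and> (\<forall>x. q x \<le> p x)"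
      using CA by (auto simp: A_def)
    have b1: "sublinear (\<lambda>x. INF q\<in>C. q x)"
      by (rule sublinear_chain_bound(1)[OF False sub chain])
    have b2: "(INF q\<in>C. q x) \<le> q x" if "q \<in> C" for q x
      by (rule sublinear_chain_bound(2)[OF False sub chain that])
    from False obtain q where q: "q \<in> C" by blast
    have "(INF q\<in>C. q x) \<le> p x" for x
      using b2[OF q, of x] sub[OF q] by (meson order_trans)
    then show ?thesis
      using b1 b2 by (intro bexI[of _ "\<lambda>x. INF q\<in>C. q x"]) (auto simp: A_def le_fun_def)
  qed
  obtain q where q: "q \<in> A" and min: "\<And>r. r \<in> A \<Longrightarrow> r \<le> q \<Longrightarrow> r = q"
    using predicate_Zorn[of A "\<lambda>q r. r \<le> q"] po ub unfolding R_def by blast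
  have sq: "sublinear q" and qp: "\<And>x. q x \<le> p x"
    using q by (auto simp: A_def)
  have superadd: "q x + q a \<le> q (x + a)" for x a
  proof -
    define r where "r = (\<lambda>x. INF t\<in>{0..}. q (x + t *\<^sub>R a) - t * q a)"
    have rsub: "sublinear r"
      unfolding r_def by (rule sublinear_directional_inf(1)[OF sq])
    have rlow: "r x \<le> q (x + t *\<^sub>R a) - t * q a" if "0 \<le> t" for x t
      unfolding r_def by (rule sublinear_directional_inf(2)[OF sq that])
    have rq: "r x \<le> q x" for x
      using rlow[of 0 x] by simp
    then have "r = q"
      using rsub qp by (intro min) (auto simp: A_def le_fun_def intro: order_trans)
    then show ?thesis
      using rlow[of 1 x] by simp
  qed
  have add: "q (x + y) = q x + q y" for x y
    using superadd[of x y] sublinear_add[OF sq, of x y] by simp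
  have neg: "q (- x) = - q x" for x
    using add[of x "- x"] sublinear_zero[OF sq] by simp
  have scale: "q (c *\<^sub>R x) = c * q x" for c x
  proof -
    consider "0 < c" | "c = 0" | "0 < - c" by linarith
    then show ?thesis
    proof cases
      case 3
      then show ?thesis
        using sublinear_scale[OF sq 3, of x] neg[of "c *\<^sub>R x"] by simp
    qed (use sublinear_scale[OF sq] sublinear_zero[OF sq] in auto)
  qed
  have "linear q"
    using add scale by (intro linearI) auto
  then show ?thesis
    using qp that by blast
qed

text \<open>The functional is a linear minorant of the directional derivative at 0 of the
  perturbation function sending w to the infimum of r + g (z + w) - m over (z, r) in C.\<close>

lemma fenchel_duality:
  fixes C :: "('v::real_normed_vector \<times> real) set" and g :: "'v \<Rightarrow> real"
  assumes convC: "convex C" and ne: "C \<noteq> {}" and convg: "convex_on UNIV g"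
    and bound: "\<And>x. norm x \<le> 1 \<Longrightarrow> g (a + x) \<le> K"
    and lower: "\<And>z r. (z, r) \<in> C \<Longrightarrow> m \<le> r + g z"
  shows "\<exists>L :: 'v \<Rightarrow>\<^sub>L real. \<forall>y z r. (z, r) \<in> C \<longrightarrow> L y - L z + m \<le> r + g y"
proof -
  define I where "I = {0::real<..} \<times> C"
  define F where "F = (\<lambda>w (t, z, r). (r + g (z + t *\<^sub>R w) - m) / t)"
  define p where "p = (\<lambda>w. INF i\<in>I. F w i)"
  have neI: "I \<noteq> {}" using ne by (auto simp: I_def)
  have comb: "\<exists>i\<in>I. F (v + w) i \<le> F v i1 + F w i2" if i: "i1 \<in> I" "i2 \<in> I" for v w i1 i2
  proof -
    obtain t1 z1 r1 where i1: "i1 = (t1, z1, r1)" "0 < t1" "(z1, r1) \<in> C"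
      using i(1) by (auto simp: I_def)
    obtain t2 z2 r2 where i2: "i2 = (t2, z2, r2)" "0 < t2" "(z2, r2) \<in> C"
      using i(2) by (auto simp: I_def)
    \<comment> \<open>The weights solve \<open>l1 * t1 = l2 * t2\<close>, so that both directions
      \<open>v\<close> and \<open>w\<close> get the same step \<open>t\<close> in the convex
      combination.\<close>
    define l1 l2 t where "l1 = t2 / (t1 + t2)" and "l2 = t1 / (t1 + t2)" and "t = t1 * t2 / (t1 + t2)"
    have l: "0 \<le> l1" "0 \<le> l2" "l1 + l2 = 1" "0 < t"
      using i1 i2 by (auto simp: l1_def l2_def t_def add_divide_distrib[symmetric])
    have lt: "l1 * t1 = t" "l2 * t2 = t"
      by (auto simp: l1_def l2_def t_def)
    define z r where "z = l1 *\<^sub>R z1 + l2 *\<^sub>R z2" and "r = l1 * r1 + l2 * r2"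
    have zr: "(z, r) \<in> C"
      using convexD[OF convC i1(3) i2(3) l(1-3)] by (simp add: z_def r_def)
    have "z + t *\<^sub>R (v + w) = l1 *\<^sub>R (z1 + t1 *\<^sub>R v) + l2 *\<^sub>R (z2 + t2 *\<^sub>R w)"
      by (simp add: z_def algebra_simps lt)
    then have "g (z + t *\<^sub>R (v + w)) \<le> l1 * g (z1 + t1 *\<^sub>R v) + l2 * g (z2 + t2 *\<^sub>R w)"
      using convg l by (simp add: convex_on_def)
    moreover have "m = l1 * m + l2 * m"
      using l(3) by (metis distrib_right mult_1)
    ultimately have "r + g (z + t *\<^sub>R (v + w)) - m
        \<le> l1 * (r1 + g (z1 + t1 *\<^sub>R v) - m) + l2 * (r2 + g (z2 + t2 *\<^sub>R w) - m)"
      by (simp add: r_def algebra_simps)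
    also have "\<dots> = t * (F v i1 + F w i2)"
    proof -
      have "l1 * x = t * (x / t1)" "l2 * x = t * (x / t2)" for x
        using i1(2) i2(2) lt by (auto simp: field_simps)
      then show ?thesis
        by (simp add: F_def i1(1) i2(1) distrib_left)
    qed
    finally have "F (v + w) (t, z, r) \<le> F v i1 + F w i2"
      using l(4) by (simp add: F_def field_simps)
    then show ?thesis
      using zr l(4) by (intro bexI[of _ "(t, z, r)"]) (auto simp: I_def)
  qed
  have F0: "0 \<le> F 0 i" if "i \<in> I" for i
    using that lower by (auto simp: I_def F_def)
  \<comment> \<open>Subadditivity for \<open>w\<close> and \<open>- w\<close>, together with
    \<open>F0\<close>, bounds \<open>F w\<close> from below by any single value of
    \<open>- F (- w)\<close>.\<close>
  have bdd: "bdd_below (F w ` I)" for w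
  proof -
    obtain i0 where i0: "i0 \<in> I" using neI by blast
    show ?thesis
    proof (rule bdd_belowI2)
      fix i assume "i \<in> I"
      then show "- F (- w) i0 \<le> F w i"
        using comb[of i i0 w "- w"] i0 F0 by force
    qed
  qed
  have low: "p w \<le> F w i" if "i \<in> I" for w i
    unfolding p_def using bdd that by (rule cINF_lower)
  have "sublinear p"
    unfolding sublinear_def
  proof (intro conjI allI impI)
    fix v w
    have *: "p (v + w) \<le> F v i1 + F w i2" if "i1 \<in> I" "i2 \<in> I" for i1 i2
      using comb[OF that, of v w] low by (meson order_trans)
    have "p (v + w) - F w i2 \<le> (INF i\<in>I. F v i)" if "i2 \<in> I" for i2
      using * that neI by (intro cINF_greatest) (auto simp: algebra_simps)
    then have "p (v + w) - p v \<le> (INF i\<in>I. F w i)"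
      using neI by (intro cINF_greatest) (auto simp: p_def algebra_simps)
    then show "p (v + w) \<le> p v + p w"
      by (simp add: p_def)
  next
    fix c :: real and w assume c: "0 < c"
    define s where "s = (\<lambda>(t, z, r). (c * t, z :: 'v, r :: real))"
    have eq: "c * F w (s i) = F (c *\<^sub>R w) i" if "i \<in> I" for i
      using c that by (auto simp: F_def s_def I_def mult.commute)
    have im: "s ` I = I"
    proof (intro equalityI subsetI)
      fix i assume "i \<in> I"
      then show "i \<in> s ` I"
        using c by (intro image_eqI[of _ _ "(fst i / c, snd i)"]) (auto simp: I_def s_def)
    qed (use c in \<open>auto simp: I_def s_def\<close>)
    have "c * p w = c * (INF i\<in>s ` I. F w i)"
      by (simp add: p_def im)
    also have "\<dots> = (INF i\<in>s ` I. c * F w i)"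
      using cINF_scale_pos[OF neI bdd c] by (simp add: im)
    also have "\<dots> = p (c *\<^sub>R w)"
      unfolding image_image p_def using eq by (intro INF_cong) auto
    finally show "p (c *\<^sub>R w) = c * p w" ..
  qed
  then obtain f where f: "linear f" "\<And>x. f x \<le> p x"
    using sublinear_dominates_linear by blast
  have main: "f y - f z + m \<le> r + g y" if "(z, r) \<in> C" for y z r
  proof -
    \<comment> \<open>Step length 1 from \<open>z\<close> in the direction \<open>y - z\<close>
      lands exactly at \<open>y\<close>.\<close>
    have "f (y - z) \<le> F (y - z) (1, z, r)"
      using f(2)[of "y - z"] low[of "(1, z, r)" "y - z"] that by (auto simp: I_def)
    then show ?thesis
      using f(1) by (simp add: F_def linear_diff)
  qed
  obtain z0 r0 where z0: "(z0, r0) \<in> C" using ne by auto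
  \<comment> \<open>Continuity of \<open>f\<close>: on the ball around \<open>a\<close> the function
    \<open>g\<close> is at most \<open>K\<close>, so \<open>main\<close> with the single point
    \<open>z0\<close> bounds \<open>f\<close> from above on the unit ball.\<close>
  define M where "M = r0 + K + f z0 - m - f a"
  have fM: "f x \<le> M" if "norm x \<le> 1" for x
    using main[OF z0, of "a + x"] bound[OF that] f(1) by (simp add: M_def linear_add)
  have "bounded_linear f"
  proof (rule bounded_linear_intro[where K = M])
    show "f (x + y) = f x + f y" "f (c *\<^sub>R x) = c *\<^sub>R f x" for x y c
      using f(1) by (auto simp: linear_add linear_scale)
    show "norm (f x) \<le> norm x * M" for x
    proof (cases "x = 0")
      case True
      then show ?thesis using f(1) by (simp add: linear_0)
    next
      case False
      then have "f (inverse (norm x) *\<^sub>R x) \<le> M" "f (inverse (norm x) *\<^sub>R (- x)) \<le> M"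
        by (auto intro!: fM)
      then have "inverse (norm x) * f x \<le> M" "inverse (norm x) * (- f x) \<le> M"
        using f(1) linear_scale[OF f(1)] linear_neg[OF f(1)] by (metis real_scaleR_def)+
      then show ?thesis
        using False by (simp add: abs_le_iff field_simps)
    qed
  qed
  then have "blinfun_apply (Blinfun f) = f"
    by (rule bounded_linear_Blinfun_apply)
  with main show ?thesis
    by (intro exI[of _ "Blinfun f"]) simp
qed

section \<open>The duality product\<close>

definition pairing :: "'a::real_normed_vector \<times> 'a dual \<Rightarrow> real"
  where "pairing z = blinfun_apply (snd z) (fst z)"

text \<open>The symmetric bilinear form that polarises \<open>pairing\<close>. The affine functions
  \<open>polar t z - pairing t\<close> of \<open>z\<close>, for \<open>t\<close> in
  \<open>T\<close>, are those whose supremum is the Fitzpatrick function.\<close>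

definition polar :: "'a::real_normed_vector \<times> 'a dual \<Rightarrow> 'a \<times> 'a dual \<Rightarrow> real"
  where "polar z w = blinfun_apply (snd z) (fst w) + blinfun_apply (snd w) (fst z)"

lemma pairing_Pair [simp]: "pairing (x, x') = blinfun_apply x' x"
  by (simp add: pairing_def)

lemma polar_commute: "polar z w = polar w z"
  by (simp add: polar_def)

lemma polar_add_left: "polar (u + z) w = polar u w + polar z w"
  and polar_add_right: "polar w (u + z) = polar w u + polar w z"
  and polar_diff_left: "polar (u - z) w = polar u w - polar z w"
  and polar_diff_right: "polar w (u - z) = polar w u - polar w z"
  and polar_scaleR_left: "polar (c *\<^sub>R z) w = c * polar z w"
  and polar_scaleR_right: "polar w (c *\<^sub>R z) = c * polar w z"
  and polar_self: "polar z z = 2 * pairing z"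
  by (simp_all add: polar_def pairing_def blinfun.bilinear_simps algebra_simps)

lemmas polar_simps = polar_add_left polar_add_right polar_diff_left polar_diff_right
  polar_scaleR_left polar_scaleR_right polar_self

lemma pairing_add: "pairing (z + w) = pairing z + polar z w + pairing w"
  and pairing_diff: "pairing (z - w) = pairing z - polar z w + pairing w"
  and pairing_scaleR: "pairing (c *\<^sub>R z) = c\<^sup>2 * pairing z"
  by (simp_all add: polar_def pairing_def blinfun.bilinear_simps algebra_simps power2_eq_square)

lemma norm_prod_square: "(norm z)\<^sup>2 = (norm (fst z))\<^sup>2 + (norm (snd z))\<^sup>2"
  by (simp add: norm_prod_def)

text \<open>Cauchy--Schwarz in the plane. The spaces of \<open>a\<close>, \<open>b\<close> and the
  components of \<open>d\<close> are unrelated, so that pairs from X* \<times> X** are covered as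
  well.\<close>

lemma sum_prod_le_norm_prod:
  "norm a * norm (fst d) + norm b * norm (snd d) \<le> norm (a, b) * norm d"
proof -
  have "(norm a * norm (fst d) + norm b * norm (snd d))\<^sup>2
      \<le> ((norm a)\<^sup>2 + (norm b)\<^sup>2) * ((norm (fst d))\<^sup>2 + (norm (snd d))\<^sup>2)"
    using zero_le_power2[of "norm a * norm (snd d) - norm b * norm (fst d)"]
    by (simp add: power2_eq_square algebra_simps)
  then show ?thesis
    by (simp add: norm_prod_def real_sqrt_mult[symmetric] real_le_rsqrt)
qed

lemma blinfun_real_le: "blinfun_apply (f :: 'b::real_normed_vector \<Rightarrow>\<^sub>L real) x \<le> norm f * norm x"
  using norm_blinfun[of f x] by simp

lemma polar_le: "polar z w \<le> norm z * norm w"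
proof -
  have "polar z w \<le> norm (snd z) * norm (fst w) + norm (snd w) * norm (fst z)"
    unfolding polar_def by (intro add_mono blinfun_real_le)
  also have "\<dots> \<le> norm (snd z, fst z) * norm w"
    using sum_prod_le_norm_prod[of "snd z" w "fst z"] by (simp add: mult.commute)
  also have "norm (snd z, fst z) = norm z"
    by (simp add: norm_prod_def add.commute)
  finally show ?thesis .
qed

lemma pairing_le: "pairing z \<le> (norm z)\<^sup>2 / 2"
  using polar_le[of z z] by (simp add: polar_self power2_eq_square)

text \<open>Makes \<open>pairing z + (norm z)\<^sup>2 / 2\<close> nonnegative, which is why the
  infima of conditions 3 and 4 cannot be negative.\<close>

lemma pairing_ge: "- (norm z)\<^sup>2 / 2 \<le> pairing z"
  using polar_le[of z "- z"] polar_scaleR_right[of z "-1" z]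
  by (simp add: polar_self power2_eq_square)

lemma tendsto_pairing: "(f \<longlongrightarrow> l) F \<Longrightarrow> ((\<lambda>n. pairing (f n)) \<longlongrightarrow> pairing l) F"
  unfolding pairing_def by (intro tendsto_intros)

lemma tendsto_polar: "(f \<longlongrightarrow> l) F \<Longrightarrow> ((\<lambda>n. polar t (f n)) \<longlongrightarrow> polar t l) F"
  unfolding polar_def by (intro tendsto_intros)

section \<open>Half the squared norm and its conjugate\<close>

lemma convex_on_half_norm_square:
  "convex_on UNIV (\<lambda>z::'b::real_normed_vector. (norm z)\<^sup>2 / 2)"
proof (rule convex_onI)
  fix t :: real and x y :: 'b assume t: "0 < t" "t < 1"
  have "norm ((1 - t) *\<^sub>R x + t *\<^sub>R y) \<le> (1 - t) * norm x + t * norm y"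
    using norm_triangle_ineq[of "(1 - t) *\<^sub>R x" "t *\<^sub>R y"] t by simp
  then have "(norm ((1 - t) *\<^sub>R x + t *\<^sub>R y))\<^sup>2 \<le> ((1 - t) * norm x + t * norm y)\<^sup>2"
    by (intro power_mono) auto
  also have "\<dots> = (1 - t) * (norm x)\<^sup>2 + t * (norm y)\<^sup>2 - t * (1 - t) * (norm x - norm y)\<^sup>2"
    by (simp add: power2_eq_square algebra_simps)
  also have "\<dots> \<le> (1 - t) * (norm x)\<^sup>2 + t * (norm y)\<^sup>2"
    using t by simp
  finally show "(norm ((1 - t) *\<^sub>R x + t *\<^sub>R y))\<^sup>2 / 2
      \<le> (1 - t) * ((norm x)\<^sup>2 / 2) + t * ((norm y)\<^sup>2 / 2)"
    by simp
qed simp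

text \<open>Half the squared norm is conjugate to half the squared dual norm. The supremum need not
  be attained without reflexivity, so an almost norming vector is scaled to the length
  \<open>norm L\<close>.\<close>

lemma half_norm_square_conjugate_approx:
  fixes L :: "'b::real_normed_vector \<Rightarrow>\<^sub>L real"
  assumes "0 < e"
  obtains a where "(norm a)\<^sup>2 / 2 - L a \<le> - (norm L)\<^sup>2 / 2 + e"
proof (cases "L = 0")
  case True
  then show ?thesis using assms that[of 0] by simp
next
  case False
  \<comment> \<open>The slack is chosen so that multiplying by \<open>norm L\<close> costs at most
    \<open>e\<close>; the maximum with 0 ensures \<open>L x \<noteq> 0\<close> for the vector found
    next.\<close>
  define c where "c = max 0 (norm L - e / norm L)"
  have c: "c < norm L" "0 \<le> c" "(norm L)\<^sup>2 - c * norm L \<le> e"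
    using False assms by (auto simp: c_def max_def power2_eq_square field_simps)
  obtain x where x: "c * norm x < norm (L x)"
    using norm_blinfun_bound[of c L] c by (meson not_le)
  define b where "b = sgn (L x) *\<^sub>R x"
  have b: "c * norm b < L b"
  proof -
    have "L x \<noteq> 0"
      using x mult_nonneg_nonneg[OF c(2) norm_ge_zero[of x]] by (auto simp del: mult_nonneg_nonneg)
    then show ?thesis
      using x by (simp add: b_def blinfun.scaleR_right abs_sgn_eq linordered_idom_class.abs_sgn mult.commute)
  qed
  then have nb: "norm b \<noteq> 0" by auto
  define a where "a = (norm L / norm b) *\<^sub>R b"
  have na: "norm a = norm L" using nb by (simp add: a_def)
  have "c * norm L \<le> norm L / norm b * L b"
    using nb mult_left_mono[OF less_imp_le[OF b] norm_ge_zero[of L]] by (simp add: field_simps)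
  then have "c * norm L \<le> L a"
    by (simp add: a_def blinfun.scaleR_right)
  then show ?thesis
    using c(3) that[of a] by (simp add: na)
qed

section \<open>Monotone operators and the Fitzpatrick family\<close>

lemma monotone_operator_iff:
  "monotone_operator T \<longleftrightarrow> (\<forall>s\<in>T. \<forall>t\<in>T. 0 \<le> pairing (s - t))"
  by (fastforce simp: monotone_operator_def pairing_def)

text \<open>Inserting \<open>z\<close> keeps \<open>T\<close> monotone. All later appeals to
  maximality take this form.\<close>

lemma maximal_monotone_memI:
  assumes "maximal_monotone T" "\<And>t. t \<in> T \<Longrightarrow> 0 \<le> pairing (z - t)"
  shows "z \<in> T"
proof -
  have sym: "pairing (t - z) = pairing (z - t)" for t
    using pairing_scaleR[of "-1" "z - t"] by simp
  have "monotone_operator (insert z T)"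
    using assms sym by (auto simp: maximal_monotone_def monotone_operator_iff pairing_def[of 0])
  then show ?thesis
    using assms(1) unfolding maximal_monotone_def by blast
qed

lemma maximal_monotone_nonempty: "maximal_monotone T \<Longrightarrow> T \<noteq> {}"
  using maximal_monotone_memI[of T 0] by blast

lemma fitzpatrick_family_ge: "h \<in> fitzpatrick_family T \<Longrightarrow> ereal (pairing z) \<le> h z"
  by (cases z) (simp add: fitzpatrick_family_def)

lemma fitzpatrick_family_eq: "h \<in> fitzpatrick_family T \<Longrightarrow> t \<in> T \<Longrightarrow> h t = ereal (pairing t)"
  by (cases t) (auto simp: fitzpatrick_family_def)

lemma fitzpatrick_family_convex:
  assumes "h \<in> fitzpatrick_family T" "h z \<le> ereal r" "h w \<le> ereal s" "0 \<le> u" "0 \<le> v" "u + v = 1"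
  shows "h (u *\<^sub>R z + v *\<^sub>R w) \<le> ereal (u * r + v * s)"
proof -
  have "convex {(z, r :: real). h z \<le> ereal r}"
    using assms(1) by (simp add: fitzpatrick_family_def ereal_convex_def)
  from convexD[OF this, of "(z, r)" "(w, s)" u v] assms(2-) show ?thesis
    by simp
qed

text \<open>Every member of the family lies above the Fitzpatrick function: on the segment from
  \<open>t\<close> to \<open>z\<close>, convexity bounds \<open>h\<close> from above and the pairing
  bounds it from below, with equality of \<open>h\<close> and the pairing at \<open>t\<close>.
  Dividing by the parameter \<open>u\<close> and letting it tend to 0 gives the tangent
  inequality.\<close>

lemma fitzpatrick_family_ge_polar:
  assumes h: "h \<in> fitzpatrick_family T" and t: "t \<in> T" and hz: "h z \<le> ereal r"
  shows "polar t z - pairing t \<le> r"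
proof -
  have "polar t z - pairing t + u * (pairing t - polar t z + pairing z) \<le> r" if u: "0 < u" "u < 1" for u
  proof -
    have "ereal (pairing ((1 - u) *\<^sub>R t + u *\<^sub>R z)) \<le> h ((1 - u) *\<^sub>R t + u *\<^sub>R z)"
      by (rule fitzpatrick_family_ge[OF h])
    also have "\<dots> \<le> ereal ((1 - u) * pairing t + u * r)"
      using u fitzpatrick_family_eq[OF h t] hz by (intro fitzpatrick_family_convex[OF h]) auto
    finally have "u * (polar t z - pairing t + u * (pairing t - polar t z + pairing z)) \<le> u * r"
      unfolding pairing_add pairing_scaleR polar_simps
      by (simp add: power2_eq_square algebra_simps)
    then show ?thesis
      using u by simp
  qed
  then have "\<forall>\<^sub>F u in at_right 0. polar t z - pairing t + u * (pairing t - polar t z + pairing z) \<le> r"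
    by (subst eventually_at_right[of 0 1]) (auto intro!: exI[of _ 1])
  moreover have "((\<lambda>u. polar t z - pairing t + u * (pairing t - polar t z + pairing z))
      \<longlongrightarrow> polar t z - pairing t + 0 * (pairing t - polar t z + pairing z)) (at_right 0)"
    by (intro tendsto_intros)
  ultimately show ?thesis
    using tendsto_upperbound[of _ "polar t z - pairing t + 0 * (pairing t - polar t z + pairing z)"
        "at_right (0::real)"] by fastforce
qed

text \<open>At such a point the tangent inequality with \<open>r = pairing z\<close> says that
  \<open>z\<close> is monotonically related to every point of \<open>T\<close>.\<close>

lemma fitzpatrick_family_contact:
  assumes "maximal_monotone T" and h: "h \<in> fitzpatrick_family T" and hz: "h z \<le> ereal (pairing z)"
  shows "z \<in> T"
proof (rule maximal_monotone_memI[OF assms(1)])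
  fix t assume "t \<in> T"
  from fitzpatrick_family_ge_polar[OF h this hz] show "0 \<le> pairing (z - t)"
    by (simp add: pairing_diff polar_commute[of t])
qed

text \<open>Lower semicontinuity as sequential closedness of the epigraph, for use at the limit of
  the iteration.\<close>

lemma fitzpatrick_family_sequential_limit:
  assumes h: "h \<in> fitzpatrick_family T"
    and f: "f \<longlonglongrightarrow> l" and r: "r \<longlonglongrightarrow> c" and le: "\<And>n. h (f n) \<le> ereal (r n)"
  shows "h l \<le> ereal c"
proof (rule ccontr)
  assume "\<not> h l \<le> ereal c"
  then obtain d where d: "c < d" "ereal d < h l"
    using ereal_dense2[of "ereal c" "h l"] by (auto simp: not_le)
  have "h l \<le> Liminf (at l) h"
    using h unfolding fitzpatrick_family_def lower_semicontinuous_def by blast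
  then have "\<forall>\<^sub>F z in at l. ereal d < h z"
    using d(2) less_LiminfD[of "ereal d" "at l" h] by (metis less_le_trans)
  \<comment> \<open>The limit inferior ignores \<open>l\<close> itself, a value the sequence may
    take; there the bound holds by the choice of \<open>d\<close>.\<close>
  then have "\<forall>\<^sub>F z in nhds l. ereal d < h z"
    using d(2) by (auto simp: eventually_at_filter elim: eventually_mono)
  then have "\<forall>\<^sub>F n in sequentially. ereal d < h (f n)"
    using f by (auto simp: filterlim_iff)
  moreover have "\<forall>\<^sub>F n in sequentially. r n < d"
    using r d(1) by (rule order_tendstoD)
  ultimately have "\<forall>\<^sub>F n in sequentially. False"
  proof eventually_elim
    case (elim n)
    then have "ereal d < ereal d"
      using le[of n] by (meson ereal_less_eq(3) less_le_trans less_imp_le)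
    then show False by simp
  qed
  then show False by simp
qed

text \<open>The summand equals \<open>pairing z - pairing (z - t)\<close>, so the excess over
  \<open>pairing z\<close> measures how far \<open>z\<close> is from being monotonically related to
  \<open>T\<close>.\<close>

definition fitzpatrick_function :: "('a::real_normed_vector \<times> 'a dual) set \<Rightarrow> 'a \<times> 'a dual \<Rightarrow> ereal"
  where "fitzpatrick_function T z = (SUP t\<in>T. ereal (polar t z - pairing t))"

text \<open>A supremum of continuous affine functions is convex and lower semicontinuous. Maximality
  yields the lower bound by the pairing, monotonicity the equality on \<open>T\<close>. This witness
  lets the universal conditions imply the existential ones.\<close>

lemma fitzpatrick_function_in_family:
  assumes T: "maximal_monotone T"
  shows "fitzpatrick_function T \<in> fitzpatrick_family T"
proof -
  have conv: "ereal_convex (fitzpatrick_function T)"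
    unfolding ereal_convex_def
  proof (rule convexI)
    fix p q :: "('a \<times> 'a dual) \<times> real" and u v :: real
    assume *: "p \<in> {(z, r). fitzpatrick_function T z \<le> ereal r}"
      "q \<in> {(z, r). fitzpatrick_function T z \<le> ereal r}" and u: "0 \<le> u" "0 \<le> v" "u + v = 1"
    obtain z r w s where pq: "p = (z, r)" "q = (w, s)" by (metis surj_pair)
    have "polar t (u *\<^sub>R z + v *\<^sub>R w) - pairing t \<le> u * r + v * s" if "t \<in> T" for t
    proof -
      have "u * (polar t z - pairing t) + v * (polar t w - pairing t) \<le> u * r + v * s"
        using * that u by (intro add_mono mult_left_mono) (auto simp: fitzpatrick_function_def SUP_le_iff pq)
      moreover have "pairing t = u * pairing t + v * pairing t"
        using u(3) by (metis distrib_right mult_1)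
      ultimately show ?thesis
        by (simp add: polar_simps algebra_simps)
    qed
    then show "u *\<^sub>R p + v *\<^sub>R q \<in> {(z, r). fitzpatrick_function T z \<le> ereal r}"
      by (auto simp: pq fitzpatrick_function_def SUP_le_iff)
  qed
  have lsc: "lower_semicontinuous (fitzpatrick_function T)"
    unfolding lower_semicontinuous_def
  proof
    fix z
    show "fitzpatrick_function T z \<le> Liminf (at z) (fitzpatrick_function T)"
      unfolding le_Liminf_iff
    proof (intro allI impI)
      fix c assume "c < fitzpatrick_function T z"
      then obtain t where t: "t \<in> T" "c < ereal (polar t z - pairing t)"
        by (auto simp: fitzpatrick_function_def less_SUP_iff)
      have "((\<lambda>w. ereal (polar t w - pairing t)) \<longlongrightarrow> ereal (polar t z - pairing t)) (at z)"
        by (intro tendsto_intros tendsto_polar)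
      from order_tendstoD(1)[OF this t(2)] show "\<forall>\<^sub>F w in at z. c < fitzpatrick_function T w"
        by eventually_elim (use t(1) in \<open>auto simp: fitzpatrick_function_def less_SUP_iff\<close>)
    qed
  qed
  \<comment> \<open>If the bound failed, \<open>z\<close> would be monotonically related to
    \<open>T\<close> and hence belong to it; but then the choice \<open>t = z\<close> already
    attains \<open>pairing z\<close>.\<close>
  have ge: "ereal (pairing z) \<le> fitzpatrick_function T z" for z
  proof (rule ccontr)
    assume "\<not> ?thesis"
    then have *: "polar t z - pairing t < pairing z" if "t \<in> T" for t
      using that SUP_upper[of t T "\<lambda>t. ereal (polar t z - pairing t)"]
      by (auto simp: fitzpatrick_function_def not_le dest: le_less_trans)
    have "z \<in> T"
    proof (rule maximal_monotone_memI[OF T])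
      fix t assume "t \<in> T"
      from *[OF this] show "0 \<le> pairing (z - t)"
        by (simp add: pairing_diff polar_commute[of z])
    qed
    with *[of z] show False
      by (simp add: polar_self)
  qed
  have "fitzpatrick_function T z \<le> ereal (pairing z)" if "z \<in> T" for z
    unfolding fitzpatrick_function_def
  proof (rule SUP_least)
    fix t assume "t \<in> T"
    then have "0 \<le> pairing (z - t)"
      using T that by (simp add: maximal_monotone_def monotone_operator_iff)
    then show "ereal (polar t z - pairing t) \<le> ereal (pairing z)"
      by (simp add: pairing_diff polar_commute[of z])
  qed
  then have "fitzpatrick_function T z = ereal (pairing z)" if "z \<in> T" for z
    using that ge by (simp add: antisym)
  with conv lsc ge show ?thesis
    by (auto simp: fitzpatrick_family_def simp flip: pairing_Pair)
qed

section \<open>The infimum condition\<close>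

text \<open>As translate h z0 z equals h (z0 + z) - pairing (z0 + z) + pairing z, this says that the
  infima in conditions 3 and 4 are at most 0.\<close>

definition inf_condition :: "('a::real_normed_vector \<times> 'a dual \<Rightarrow> ereal) \<Rightarrow> bool"
  where "inf_condition h \<longleftrightarrow> (\<forall>z\<^sub>0. \<forall>e>0. \<exists>z.
    h (z\<^sub>0 + z) < ereal (pairing (z\<^sub>0 + z) - pairing z - (norm z)\<^sup>2 / 2 + e))"

text \<open>A strict comparison with a real number allows the finite terms to change sides even when
  \<open>h\<close> takes an infinite value.\<close>

lemma translate_less_iff:
  fixes h :: "'a::real_normed_vector \<times> 'a dual \<Rightarrow> ereal"
  shows "translate h (x\<^sub>0, x\<^sub>0') (x, x') + ereal (1/2 * (norm x)\<^sup>2 + 1/2 * (norm x')\<^sup>2) < ereal e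
    \<longleftrightarrow> h ((x\<^sub>0, x\<^sub>0') + (x, x'))
      < ereal (pairing ((x\<^sub>0, x\<^sub>0') + (x, x')) - pairing (x, x') - (norm (x, x'))\<^sup>2 / 2 + e)"
proof -
  have *: "u - ereal c + ereal n < ereal e \<longleftrightarrow> u < ereal (c - n + e)" for u c n
    by (cases u) auto
  have "pairing ((x\<^sub>0, x\<^sub>0') + (x, x')) - pairing (x, x')
      = blinfun_apply x\<^sub>0' x + blinfun_apply x' x\<^sub>0 + blinfun_apply x\<^sub>0' x\<^sub>0"
    by (simp add: pairing_def blinfun.bilinear_simps)
  moreover have "(norm (x, x'))\<^sup>2 / 2 = 1/2 * (norm x)\<^sup>2 + 1/2 * (norm x')\<^sup>2"
    by (simp add: norm_prod_square add_divide_distrib)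
  moreover have "(x\<^sub>0, x\<^sub>0') + (x, x') = (x + x\<^sub>0, x' + x\<^sub>0')"
    by (simp add: add.commute)
  ultimately show ?thesis
    unfolding translate_def prod.case by (simp only: *)
qed

text \<open>Since \<open>h\<close> dominates the pairing, \<open>pairing_ge\<close> makes every term
  of the infimum nonnegative; it vanishes exactly when there are arbitrarily small terms.\<close>

lemma inf_condition_iff:
  fixes h :: "'a::real_normed_vector \<times> 'a dual \<Rightarrow> ereal"
  assumes h: "h \<in> fitzpatrick_family T"
  shows "inf_condition h \<longleftrightarrow> (\<forall>x\<^sub>0 x\<^sub>0'. (INF (x, x'). translate h (x\<^sub>0, x\<^sub>0') (x, x')
    + ereal (1/2 * (norm x)\<^sup>2 + 1/2 * (norm x')\<^sup>2)) = 0)"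
proof -
  define F where "F = (\<lambda>(x\<^sub>0, x\<^sub>0') (x, x'). translate h (x\<^sub>0, x\<^sub>0') (x, x')
    + ereal (1/2 * (norm x)\<^sup>2 + 1/2 * (norm x')\<^sup>2))"
  have F: "F z\<^sub>0 z < ereal e
      \<longleftrightarrow> h (z\<^sub>0 + z) < ereal (pairing (z\<^sub>0 + z) - pairing z - (norm z)\<^sup>2 / 2 + e)" for z\<^sub>0 z e
    unfolding F_def using translate_less_iff[of h "fst z\<^sub>0" "snd z\<^sub>0" "fst z" "snd z" e]
    by (simp only: case_prod_unfold prod.collapse)
  have "\<not> F z\<^sub>0 z < ereal 0" for z\<^sub>0 z
  proof
    assume "F z\<^sub>0 z < ereal 0"
    then have "ereal (pairing (z\<^sub>0 + z)) < ereal (pairing (z\<^sub>0 + z) - pairing z - (norm z)\<^sup>2 / 2 + 0)"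
      unfolding F by (rule le_less_trans[OF fitzpatrick_family_ge[OF h]])
    then show False
      using pairing_ge[of z] by simp
  qed
  then have nonneg: "0 \<le> (INF z. F z\<^sub>0 z)" for z\<^sub>0
    by (intro INF_greatest) (simp add: zero_ereal_def not_less)
  have "(INF z. F z\<^sub>0 z) = 0 \<longleftrightarrow> (\<forall>e>0. \<exists>z. F z\<^sub>0 z < ereal e)" for z\<^sub>0
  proof
    assume *: "(INF z. F z\<^sub>0 z) = 0"
    show "\<forall>e>0. \<exists>z. F z\<^sub>0 z < ereal e"
    proof (intro allI impI)
      fix e :: real assume "0 < e"
      then have "(INF z. F z\<^sub>0 z) < ereal e" unfolding * by simp
      then show "\<exists>z. F z\<^sub>0 z < ereal e" unfolding INF_less_iff by blast
    qed
  next
    assume *: "\<forall>e>0. \<exists>z. F z\<^sub>0 z < ereal e"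
    have "(INF z. F z\<^sub>0 z) \<le> 0 + ereal e" if "0 < e" for e
    proof -
      obtain z where "F z\<^sub>0 z < ereal e" using * \<open>0 < e\<close> by blast
      then show ?thesis
        by (intro INF_lower2[of z]) auto
    qed
    then have "(INF z. F z\<^sub>0 z) \<le> 0"
      by (rule ereal_le_epsilon2)
    with nonneg show "(INF z. F z\<^sub>0 z) = 0"
      by (simp add: antisym)
  qed
  then have "inf_condition h \<longleftrightarrow> (\<forall>z\<^sub>0. (INF z. F z\<^sub>0 z) = 0)"
    unfolding inf_condition_def F by (simp only:)
  then show ?thesis
    by (simp only: F_def case_prod_unfold split_paired_All fst_conv snd_conv)
qed

section \<open>From the bound on the conjugate to the infimum condition\<close>

lemma blinfun_pair_split:
  fixes L :: "('b::real_normed_vector \<times> 'c::real_normed_vector) \<Rightarrow>\<^sub>L real"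
  obtains u v where "\<And>x y. blinfun_apply L (x, y) = blinfun_apply u x + blinfun_apply v y"
proof -
  have bl: "bounded_linear (\<lambda>x. blinfun_apply L (x, 0))" "bounded_linear (\<lambda>y. blinfun_apply L (0, y))"
    by (rule bounded_linear_compose[OF blinfun.bounded_linear_right],
        intro bounded_linear_Pair bounded_linear_ident bounded_linear_zero)+
  have "blinfun_apply L (x, y) = blinfun_apply (Blinfun (\<lambda>x. blinfun_apply L (x, 0))) x
      + blinfun_apply (Blinfun (\<lambda>y. blinfun_apply L (0, y))) y" for x y
    using blinfun.add_right[of L "(x, 0)" "(0, y)"] by (simp add: bounded_linear_Blinfun_apply[OF bl(1)]
        bounded_linear_Blinfun_apply[OF bl(2)])
  then show ?thesis by (rule that)
qed

lemma conjugate_ge_imp_inf_condition: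
  fixes h :: "'a::real_normed_vector \<times> 'a dual \<Rightarrow> ereal"
  assumes h: "h \<in> fitzpatrick_family T"
    and conj: "\<And>x' x''. ereal (blinfun_apply x'' x') \<le> conjugate h (x', x'')"
  shows "inf_condition h"
  unfolding inf_condition_def
proof (intro allI impI, rule ccontr)
  fix z0 :: "'a \<times> 'a dual" and e :: real
  assume e: "0 < e"
  assume none: "\<nexists>z. h (z0 + z) < ereal (pairing (z0 + z) - pairing z - (norm z)\<^sup>2 / 2 + e)"
  have neg: "ereal (pairing (z0 + z) - pairing z - (norm z)\<^sup>2 / 2 + e) \<le> h (z0 + z)" for z
    using spec[OF none[unfolded not_ex], of z] by (simp only: not_less)
  \<comment> \<open>A point that nearly realises the bound on the conjugate has a finite
    \<open>h\<close> value: \<open>\<infinity>\<close> would make its term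
    \<open>-\<infinity>\<close>, and the pairing excludes \<open>-\<infinity>\<close>.\<close>
  have finite_conj: "\<exists>w \<rho>. h (z0 + w) = ereal \<rho> \<and> blinfun_apply x'' x' - d
      < blinfun_apply x' (fst (z0 + w)) + blinfun_apply x'' (snd (z0 + w)) - \<rho>"
    if "0 < d" for x' x'' d
  proof -
    have "ereal (blinfun_apply x'' x' - d) < conjugate h (x', x'')"
      using that by (intro less_le_trans[OF _ conj[of x'' x']]) simp
    then obtain y where y: "ereal (blinfun_apply x'' x' - d)
        < ereal (blinfun_apply x' (fst y) + blinfun_apply x'' (snd y)) - h y"
      unfolding conjugate_def prod.case less_SUP_iff case_prod_unfold by force
    then have "h y \<noteq> \<infinity>" by auto
    moreover have "h y \<noteq> - \<infinity>"
      using fitzpatrick_family_ge[OF h, of y] by auto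
    ultimately obtain \<rho> where "h y = ereal \<rho>" by (cases "h y") auto
    with y show ?thesis
      by (intro exI[of _ "y - z0"] exI[of _ \<rho>]) simp
  qed
  \<comment> \<open>The epigraph of \<open>translate h z0\<close>, with the subtracted affine term
    moved to the real side.\<close>
  define C where "C = {(z, r). h (z0 + z) \<le> ereal (r + (pairing z0 + polar z0 z))}"
  have affine: "pairing (z0 + z) - pairing z = pairing z0 + polar z0 z" for z
    by (simp add: pairing_add)
  have convC: "convex C"
  proof (rule convexI)
    fix p q :: "('a \<times> 'a dual) \<times> real" and u v :: real
    assume pq: "p \<in> C" "q \<in> C" and u: "0 \<le> u" "0 \<le> v" "u + v = 1"
    obtain z r w s where [simp]: "p = (z, r)" "q = (w, s)" by (metis surj_pair)
    have v: "v = 1 - u" using u(3) by simp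
    have "h (u *\<^sub>R (z0 + z) + v *\<^sub>R (z0 + w))
      \<le> ereal (u * (r + (pairing z0 + polar z0 z)) + v * (s + (pairing z0 + polar z0 w)))"
      using pq u by (intro fitzpatrick_family_convex[OF h]) (auto simp: C_def)
    moreover have "u *\<^sub>R (z0 + z) + v *\<^sub>R (z0 + w) = z0 + (u *\<^sub>R z + v *\<^sub>R w)"
      by (simp add: v algebra_simps)
    moreover have "u * (r + (pairing z0 + polar z0 z)) + v * (s + (pairing z0 + polar z0 w))
        = u * r + v * s + (pairing z0 + polar z0 (u *\<^sub>R z + v *\<^sub>R w))"
      unfolding polar_simps by (simp add: v algebra_simps)
    ultimately show "u *\<^sub>R p + v *\<^sub>R q \<in> C"
      by (simp add: C_def)
  qed
  have neC: "C \<noteq> {}"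
  proof -
    obtain w \<rho> where "h (z0 + w) = ereal \<rho>" using finite_conj[of 1 0 0] by auto
    then have "(w, \<rho> - (pairing z0 + polar z0 w)) \<in> C" by (simp add: C_def)
    then show ?thesis by blast
  qed
  have lower: "e \<le> r + (norm z)\<^sup>2 / 2" if "(z, r) \<in> C" for z r
  proof -
    have "h (z0 + z) \<le> ereal (r + (pairing z0 + polar z0 z))"
      using that by (simp add: C_def)
    from order_trans[OF neg this]
    have "pairing (z0 + z) - pairing z - (norm z)\<^sup>2 / 2 + e \<le> r + (pairing z0 + polar z0 z)"
      by simp
    then show ?thesis
      unfolding affine by simp
  qed
  have bound: "(norm (0 + x))\<^sup>2 / 2 \<le> 1 / 2" if "norm x \<le> 1" for x :: "'a \<times> 'a dual"
    using that by (simp add: power_le_one)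
  obtain L :: "('a \<times> 'a dual) \<Rightarrow>\<^sub>L real"
    where L: "\<And>y z r. (z, r) \<in> C \<Longrightarrow> L y - L z + e \<le> r + (norm y)\<^sup>2 / 2"
    using fenchel_duality[OF convC neC convex_on_half_norm_square bound lower] by blast
  obtain u v where uv: "\<And>x y. L (x, y) = blinfun_apply u x + blinfun_apply v y"
    using blinfun_pair_split[of L] by blast
  \<comment> \<open>Three approximations cost \<open>d\<close> each: those for \<open>a\<close>, for
    \<open>b\<close> and for the conjugate. The final estimate \<open>e < 3 * d\<close> is then
    absurd.\<close>
  define d where "d = e / 4"
  have d: "0 < d" using e by (simp add: d_def)
  obtain a where a: "(norm a)\<^sup>2 / 2 - u a \<le> - (norm u)\<^sup>2 / 2 + d"
    using half_norm_square_conjugate_approx[OF d] .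
  obtain b where b: "(norm b)\<^sup>2 / 2 - v b \<le> - (norm v)\<^sup>2 / 2 + d"
    using half_norm_square_conjugate_approx[OF d] .
  \<comment> \<open>At this point all terms in \<open>z0\<close> cancel and the conjugate bound
    turns into \<open>r + L w < - v u + d\<close>.\<close>
  define x' x'' where "x' = snd z0 - u" and "x'' = canonical_injection (fst z0) - v"
  obtain w \<rho> where w: "h (z0 + w) = ereal \<rho>" "blinfun_apply x'' x' - d
      < blinfun_apply x' (fst (z0 + w)) + blinfun_apply x'' (snd (z0 + w)) - \<rho>"
    using finite_conj[OF d, of x'' x'] by blast
  define r where "r = \<rho> - (pairing z0 + polar z0 w)"
  have "(w, r) \<in> C" using w(1) by (simp add: C_def r_def)
  from L[OF this, of "(a, b)"]
  have "e \<le> r + L w + ((norm a)\<^sup>2 / 2 - u a) + ((norm b)\<^sup>2 / 2 - v b)"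
    by (simp add: uv norm_prod_square add_divide_distrib)
  moreover have "r + L w < - v u + d"
    using w(2) uv[of "fst w" "snd w"]
    by (simp add: r_def x'_def x''_def pairing_def polar_def blinfun.bilinear_simps)
  moreover have "- v u \<le> norm v * norm u"
    using blinfun_real_le[of "- v" u] by (simp add: blinfun.minus_left)
  moreover have "norm v * norm u \<le> (norm v)\<^sup>2 / 2 + (norm u)\<^sup>2 / 2"
    using zero_le_power2[of "norm v - norm u"] by (simp add: power2_diff)
  moreover have "e = 4 * d" by (simp add: d_def)
  ultimately show False
    using a b d by linarith
qed

section \<open>From the infimum condition to type (NI)\<close>

text \<open>The infimum condition bounds \<open>pairing w + (norm w)\<^sup>2 / 2\<close> from above
  for the step \<open>w\<close>. As \<open>h\<close> nearly touches the pairing at both ends,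
  convexity at the midpoint bounds \<open>pairing w\<close> from below; together they bound the
  length of \<open>w\<close>.\<close>

lemma inf_condition_step:
  fixes h :: "'a::real_normed_vector \<times> 'a dual \<Rightarrow> ereal"
  assumes h: "h \<in> fitzpatrick_family T" and cond: "inf_condition h"
    and s: "0 < s" and hz: "h z < ereal (pairing z + s\<^sup>2)"
  obtains z' where "h z' < ereal (pairing z' + (s / 2)\<^sup>2)" "norm (z' - z) \<le> 3 * s"
proof -
  define e where "e = (s / 2)\<^sup>2"
  have "0 < e" using s by (simp add: e_def)
  then obtain w where w: "h (z + w) < ereal (pairing (z + w) - pairing w - (norm w)\<^sup>2 / 2 + e)"
    using cond unfolding inf_condition_def by blast
  have small: "h (z + w) < ereal (pairing (z + w) + e)"
    by (rule less_le_trans[OF w]) (use pairing_ge[of w] in simp)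
  have "ereal (pairing (z + w)) < ereal (pairing (z + w) - pairing w - (norm w)\<^sup>2 / 2 + e)"
    using fitzpatrick_family_ge[OF h] w by (rule le_less_trans)
  then have up: "pairing w + (norm w)\<^sup>2 / 2 < e" by simp
  have "ereal (pairing ((1/2) *\<^sub>R z + (1/2) *\<^sub>R (z + w))) \<le> h ((1/2) *\<^sub>R z + (1/2) *\<^sub>R (z + w))"
    by (rule fitzpatrick_family_ge[OF h])
  also have "\<dots> \<le> ereal (1/2 * (pairing z + s\<^sup>2) + 1/2 * (pairing (z + w) + e))"
    using hz small by (intro fitzpatrick_family_convex[OF h]) auto
  finally have "- 2 * (s\<^sup>2 + e) \<le> pairing w"
    unfolding pairing_add pairing_scaleR polar_simps ereal_less_eq
    by (simp add: power2_eq_square field_simps)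
  \<comment> \<open>The two bounds give
    \<open>(norm w)\<^sup>2 / 2 \<le> 2 * s\<^sup>2 + 3 * e\<close>, where \<open>e\<close> is a
    quarter of \<open>s\<^sup>2\<close>.\<close>
  with up have "(norm w)\<^sup>2 \<le> 11 / 2 * s\<^sup>2"
    by (simp add: e_def power_divide)
  also have "\<dots> \<le> (3 * s)\<^sup>2"
    by (simp add: power_mult_distrib)
  finally have "norm w \<le> 3 * s"
    by (rule power2_le_imp_le) (use s in simp)
  with small show ?thesis
    using that[of "z + w"] by (simp add: e_def)
qed

text \<open>Halving \<open>s\<close> at each step gives a geometric series of step lengths with sum
  \<open>6 * s\<close>. Completeness enters here: the limit exists, its gap to the pairing is 0, and
  so it is a contact point.\<close>

lemma near_contact:
  fixes h :: "'a::banach \<times> 'a dual \<Rightarrow> ereal"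
  assumes T: "maximal_monotone T" and h: "h \<in> fitzpatrick_family T" and cond: "inf_condition h"
    and s: "0 < s" and hz: "h z\<^sub>0 < ereal (pairing z\<^sub>0 + s\<^sup>2)"
  obtains t where "t \<in> T" "norm (t - z\<^sub>0) \<le> 6 * s"
proof -
  \<comment> \<open>The clause for \<open>n = 0\<close> pins the start of the sequence, which
    dependent choice alone leaves open.\<close>
  have "\<exists>f. \<forall>n. (h (f n) < ereal (pairing (f n) + (s / 2 ^ n)\<^sup>2) \<and> (n = 0 \<longrightarrow> f n = z\<^sub>0))
      \<and> norm (f (Suc n) - f n) \<le> 3 * (s / 2 ^ n)"
  proof (rule dependent_nat_choice)
    show "\<exists>z. h z < ereal (pairing z + (s / 2 ^ 0)\<^sup>2) \<and> (0 = (0::nat) \<longrightarrow> z = z\<^sub>0)"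
      using hz by (intro exI[of _ "z\<^sub>0"]) simp
    fix z n
    assume "h z < ereal (pairing z + (s / 2 ^ n)\<^sup>2) \<and> (n = 0 \<longrightarrow> z = z\<^sub>0)"
    then have hz: "h z < ereal (pairing z + (s / 2 ^ n)\<^sup>2)" ..
    have "0 < s / 2 ^ n" using s by simp
    then obtain z' where "h z' < ereal (pairing z' + (s / 2 ^ n / 2)\<^sup>2)" "norm (z' - z) \<le> 3 * (s / 2 ^ n)"
      using inf_condition_step[OF h cond _ hz] by blast
    moreover have "s / 2 ^ n / 2 = s / 2 ^ Suc n" by simp
    ultimately show "\<exists>z'. (h z' < ereal (pairing z' + (s / 2 ^ Suc n)\<^sup>2) \<and> (Suc n = 0 \<longrightarrow> z' = z\<^sub>0))
        \<and> norm (z' - z) \<le> 3 * (s / 2 ^ n)"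
      by (intro exI[of _ z']) (simp only: nat.distinct simp_thms)
  qed
  then obtain f where f: "\<And>n. h (f n) < ereal (pairing (f n) + (s / 2 ^ n)\<^sup>2)" "f 0 = z\<^sub>0"
    "\<And>n. norm (f (Suc n) - f n) \<le> 3 * (s / 2 ^ n)" by auto
  have geo: "(\<lambda>n. 3 * (s / 2 ^ n)) sums (6 * s)"
    using sums_mult[OF geometric_sums[of "1/2::real"], of "3 * s"] by (simp add: power_divide)
  have summable: "summable (\<lambda>n. f (Suc n) - f n)"
    using f(3) by (rule summable_comparison_test'[OF sums_summable[OF geo]])
  define t where "t = z\<^sub>0 + (\<Sum>n. f (Suc n) - f n)"
  have "norm (t - z\<^sub>0) \<le> (\<Sum>n. 3 * (s / 2 ^ n))"
    unfolding t_def using norm_suminf_le[OF f(3) sums_summable[OF geo]] by simp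
  then have dist: "norm (t - z\<^sub>0) \<le> 6 * s"
    using sums_unique[OF geo] by simp
  have "(\<lambda>n. z\<^sub>0 + (\<Sum>k<n. f (Suc k) - f k)) \<longlonglongrightarrow> t"
    unfolding t_def by (intro tendsto_intros summable_LIMSEQ summable)
  then have lim: "f \<longlonglongrightarrow> t"
    by (simp add: sum_lessThan_telescope f(2))
  have "(\<lambda>n. s / 2 ^ n) \<longlonglongrightarrow> 0"
    by (rule LIMSEQ_divide_realpow_zero) simp
  then have "(\<lambda>n. pairing (f n) + (s / 2 ^ n)\<^sup>2) \<longlonglongrightarrow> pairing t + 0\<^sup>2"
    by (intro tendsto_intros tendsto_pairing lim)
  then have "h t \<le> ereal (pairing t + 0\<^sup>2)"
    using f(1) by (intro fitzpatrick_family_sequential_limit[OF h lim]) (auto intro: less_imp_le)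
  then have "t \<in> T"
    by (intro fitzpatrick_family_contact[OF T h]) simp
  then show ?thesis
    using dist by (rule that)
qed

text \<open>What matters is that \<open>R\<close> does not depend on \<open>s\<close>: the cross
  term between \<open>z\<close> and the error of size \<open>6 * s\<close> must vanish with
  \<open>s\<close>. The tangent inequality at one fixed point of \<open>T\<close> provides the
  bound.\<close>

lemma inf_condition_near_contact:
  fixes h :: "'a::banach \<times> 'a dual \<Rightarrow> ereal"
  assumes T: "maximal_monotone T" and h: "h \<in> fitzpatrick_family T" and cond: "inf_condition h"
  obtains R where "\<And>s. 0 < s \<Longrightarrow> s \<le> 1 \<Longrightarrow> \<exists>z. \<exists>t\<in>T. norm z \<le> R
    \<and> pairing z + (norm z)\<^sup>2 / 2 \<le> s\<^sup>2 \<and> norm (t - (z\<^sub>0 + z)) \<le> 6 * s"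
proof -
  obtain t\<^sub>0 where t0: "t\<^sub>0 \<in> T" using maximal_monotone_nonempty[OF T] by blast
  define c where "c = t\<^sub>0 - z\<^sub>0"
  \<comment> \<open>Comes from \<open>(norm z)\<^sup>2 / 2 \<le> 1 + \<bar>pairing c\<bar> + norm c
    * norm z\<close>: if \<open>norm z\<close> is at least 1, the constant is absorbed and one
    factor \<open>norm z\<close> cancels; otherwise \<open>R\<close> exceeds 1 anyway.\<close>
  define R where "R = 2 * (1 + \<bar>pairing c\<bar> + norm c)"
  have "\<exists>z. \<exists>t\<in>T. norm z \<le> R \<and> pairing z + (norm z)\<^sup>2 / 2 \<le> s\<^sup>2 \<and> norm (t - (z\<^sub>0 + z)) \<le> 6 * s"
    if s: "0 < s" "s \<le> 1" for s
  proof -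
    obtain z where z: "h (z\<^sub>0 + z) < ereal (pairing (z\<^sub>0 + z) - pairing z - (norm z)\<^sup>2 / 2 + s\<^sup>2)"
      using cond zero_less_power[OF s(1), of 2] unfolding inf_condition_def by blast
    have "ereal (pairing (z\<^sub>0 + z)) < ereal (pairing (z\<^sub>0 + z) - pairing z - (norm z)\<^sup>2 / 2 + s\<^sup>2)"
      using fitzpatrick_family_ge[OF h] z by (rule le_less_trans)
    then have up: "pairing z + (norm z)\<^sup>2 / 2 \<le> s\<^sup>2" by simp
    have "h (z\<^sub>0 + z) < ereal (pairing (z\<^sub>0 + z) + s\<^sup>2)"
      by (rule less_le_trans[OF z]) (use pairing_ge[of z] in simp)
    then obtain t where t: "t \<in> T" "norm (t - (z\<^sub>0 + z)) \<le> 6 * s"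
      using near_contact[OF T h cond s(1)] by blast
    have "polar t\<^sub>0 (z\<^sub>0 + z) - pairing t\<^sub>0 \<le> pairing (z\<^sub>0 + z) - pairing z - (norm z)\<^sup>2 / 2 + s\<^sup>2"
      using fitzpatrick_family_ge_polar[OF h t0 less_imp_le[OF z]] .
    moreover have "t\<^sub>0 = c + z\<^sub>0" by (simp add: c_def)
    ultimately have "(norm z)\<^sup>2 / 2 \<le> s\<^sup>2 + pairing c + polar c (- z)"
      using polar_scaleR_right[of c "-1" z]
      by (simp add: pairing_add polar_simps)
    also have "\<dots> \<le> 1 + \<bar>pairing c\<bar> + norm c * norm z"
      using polar_le[of c "- z"] s by (intro add_mono) (auto simp: power_le_one)
    finally have z2: "(norm z)\<^sup>2 / 2 \<le> 1 + \<bar>pairing c\<bar> + norm c * norm z" .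
    have "norm z \<le> R"
    proof (cases "1 \<le> norm z")
      case True
      then have "1 + \<bar>pairing c\<bar> \<le> (1 + \<bar>pairing c\<bar>) * norm z"
        by (simp add: mult_le_cancel_left1)
      with z2 have "norm z * norm z \<le> R * norm z"
        by (simp add: R_def power2_eq_square algebra_simps)
      then show ?thesis
        using True by (auto simp: mult_le_cancel_right)
    next
      case False
      then have "norm z \<le> 1" by simp
      also have "1 \<le> R"
        using add_nonneg_nonneg[OF abs_ge_zero[of "pairing c"] norm_ge_zero[of c]]
        by (simp add: R_def)
      finally show ?thesis .
    qed
    then show ?thesis
      using up t by blast
  qed
  then show ?thesis by (rule that)
qed

lemma inf_condition_imp_type_NI:
  fixes T :: "('a::banach \<times> 'a dual) set"
  assumes T: "maximal_monotone T" and h: "h \<in> fitzpatrick_family T" and cond: "inf_condition h"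
  shows "type_NI T"
  unfolding type_NI_def
proof (intro conjI allI T)
  fix x' :: "'a dual" and x'' :: "'a bidual"
  have "(INF (y, y')\<in>T. ereal (blinfun_apply (x'' - canonical_injection y) (x' - y'))) \<le> 0 + ereal e"
    if e: "0 < e" for e
  proof -
    have e2: "0 < e / 2" using e by simp
    obtain w where w: "(norm w)\<^sup>2 / 2 - x'' w \<le> - (norm x'')\<^sup>2 / 2 + e / 2"
      using half_norm_square_conjugate_approx[OF e2] .
    \<comment> \<open>Bounds the part linear in \<open>d\<close>. The choice of \<open>w\<close>
      contributes \<open>- V\<^sup>2 / 2\<close> and the infimum condition
      \<open>- (norm z)\<^sup>2 / 2\<close>; with \<open>V * norm z\<close> they complete a
      square.\<close>
    define V where "V = norm (w, x'')"
    have V2: "V\<^sup>2 = (norm w)\<^sup>2 + (norm x'')\<^sup>2"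
      by (simp add: V_def norm_prod_square)
    obtain R where R: "\<And>s. 0 < s \<Longrightarrow> s \<le> 1 \<Longrightarrow> \<exists>z. \<exists>t\<in>T. norm z \<le> R
      \<and> pairing z + (norm z)\<^sup>2 / 2 \<le> s\<^sup>2 \<and> norm (t - ((0, x' + w) + z)) \<le> 6 * s"
      using inf_condition_near_contact[OF T h cond] by blast
    obtain z\<^sub>1 :: "'a \<times> 'a dual" where "norm z\<^sub>1 \<le> R" using R[of 1] by fastforce
    then have R0: "0 \<le> R" using norm_ge_zero[of z\<^sub>1] by linarith
    \<comment> \<open>Collects the remaining terms
      \<open>19 * s\<^sup>2 + 6 * V * s + 6 * R * s\<close>, using
      \<open>s\<^sup>2 \<le> s\<close>.\<close>
    define K where "K = 19 + 6 * V + 6 * R"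
    have K: "0 < K" using R0 by (simp add: K_def V_def add_pos_nonneg)
    define s where "s = min 1 (e / 2 / K)"
    have s: "0 < s" "s \<le> 1" "K * s \<le> e / 2"
      using e K by (auto simp: s_def min_def field_simps)
    obtain z t where t: "t \<in> T" and z: "norm z \<le> R" "pairing z + (norm z)\<^sup>2 / 2 \<le> s\<^sup>2"
      "norm (t - ((0, x' + w) + z)) \<le> 6 * s"
      using R[OF s(1,2)] by blast
    obtain y y' where ty: "t = (y, y')" by (cases t)
    \<comment> \<open>The displacement of \<open>t\<close> from the base point; \<open>g\<close> is
      the part of it caused by moving into \<open>T\<close>.\<close>
    define d where "d = t - (0, x' + w)"
    define g where "g = d - z"
    have g: "norm g \<le> 6 * s"
      using z(3) by (simp add: g_def d_def algebra_simps)
    have d: "d = z + g" by (simp add: g_def)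
    have yd: "y = fst d" "x' - y' = - w - snd d"
      by (auto simp: d_def ty)
    have "(x'' - canonical_injection y) (x' - y') = - x'' w + (w (fst d) + (- x'') (snd d)) + pairing d"
      unfolding yd by (simp add: blinfun.bilinear_simps pairing_def)
    also have "\<dots> \<le> (e / 2 - V\<^sup>2 / 2) + V * norm d + (s\<^sup>2 - (norm z)\<^sup>2 / 2 + R * (6 * s) + 18 * s\<^sup>2)"
    proof (intro add_mono)
      show "- x'' w \<le> e / 2 - V\<^sup>2 / 2"
        using w by (simp add: V2 add_divide_distrib)
      have "w (fst d) + (- x'') (snd d) \<le> norm w * norm (fst d) + norm (- x'') * norm (snd d)"
        by (intro add_mono blinfun_real_le)
      also have "\<dots> \<le> V * norm d"
        using sum_prod_le_norm_prod[of w d x''] by (simp add: V_def)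
      finally show "w (fst d) + (- x'') (snd d) \<le> V * norm d" .
      have "polar z g \<le> R * (6 * s)"
        using polar_le[of z g] mult_mono[OF z(1) g R0] by simp
      moreover have "pairing g \<le> 18 * s\<^sup>2"
        using pairing_le[of g] power_mono[OF g norm_ge_zero, of 2] by (simp add: power_mult_distrib)
      ultimately show "pairing d \<le> s\<^sup>2 - (norm z)\<^sup>2 / 2 + R * (6 * s) + 18 * s\<^sup>2"
        using z(2) by (simp add: d pairing_add)
    qed
    also have "\<dots> \<le> e / 2 + K * s"
    proof -
      have "norm d \<le> norm z + 6 * s"
        using norm_triangle_ineq[of z g] g by (simp add: d)
      then have "V * norm d \<le> V * (norm z + 6 * s)"
        by (intro mult_left_mono) (auto simp: V_def)
      moreover have "V * norm z \<le> V\<^sup>2 / 2 + (norm z)\<^sup>2 / 2"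
        using zero_le_power2[of "V - norm z"] by (simp add: power2_diff)
      moreover have "s\<^sup>2 \<le> s"
        using s by (simp add: power2_eq_square mult_le_one mult_left_le)
      ultimately show ?thesis
        by (simp add: K_def algebra_simps)
    qed
    also have "\<dots> \<le> e" using s(3) by simp
    finally show ?thesis
      using t by (intro INF_lower2[of t]) (auto simp: ty)
  qed
  then show "(INF (y, y')\<in>T. ereal (blinfun_apply (x'' - canonical_injection y) (x' - y'))) \<le> 0"
    by (rule ereal_le_epsilon2)
qed

section \<open>From type (NI) back to the bound on the conjugate\<close>

text \<open>On \<open>T\<close> the function \<open>h\<close> is the pairing, so there
  \<open>x'' x'\<close> minus a term of the conjugate is exactly the product occurring in (NI). A
  real \<open>c\<close> strictly between the conjugate and \<open>x'' x'\<close> would keep these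
  products above a positive constant.\<close>

lemma type_NI_imp_conjugate_ge:
  assumes T: "type_NI T" and h: "h \<in> fitzpatrick_family T"
  shows "ereal (blinfun_apply x'' x') \<le> conjugate h (x', x'')"
proof (rule ccontr)
  assume "\<not> ?thesis"
  then obtain c where c: "conjugate h (x', x'') < ereal c" "c < blinfun_apply x'' x'"
    using ereal_dense2 by (force simp: not_le)
  have "ereal (blinfun_apply x'' x' - c)
      \<le> (INF (y, y')\<in>T. ereal (blinfun_apply (x'' - canonical_injection y) (x' - y')))"
  proof (rule INF_greatest, clarify)
    fix y y' assume t: "(y, y') \<in> T"
    have "ereal (blinfun_apply x' y + blinfun_apply x'' y') - h (y, y') \<le> conjugate h (x', x'')"
      by (auto simp: conjugate_def intro!: SUP_upper2[of "(y, y')"])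
    from le_less_trans[OF this c(1)]
    have "blinfun_apply x' y + blinfun_apply x'' y' - blinfun_apply y' y < c"
      using fitzpatrick_family_eq[OF h t] by simp
    then show "ereal (blinfun_apply x'' x' - c)
        \<le> ereal (blinfun_apply (x'' - canonical_injection y) (x' - y'))"
      by (simp add: blinfun.bilinear_simps)
  qed
  also have "\<dots> \<le> 0"
    using T by (simp add: type_NI_def)
  finally show False
    using c(2) by simp
qed

theorem theorem1p2:
  fixes T :: "('a::banach \<times> 'a dual) set"
  defines "cond1 \<equiv> maximal_monotone T \<and>
      (\<exists>h \<in> fitzpatrick_family T.
        (\<forall>x' x''. conjugate h (x', x'') \<ge> ereal (blinfun_apply x'' x')) \<and>
        (\<forall>x x'. h (x, x') \<ge> ereal (blinfun_apply x' x)))"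
    and "cond2 \<equiv> maximal_monotone T \<and>
      (\<forall>h \<in> fitzpatrick_family T.
        (\<forall>x' x''. conjugate h (x', x'') \<ge> ereal (blinfun_apply x'' x')) \<and>
        (\<forall>x x'. h (x, x') \<ge> ereal (blinfun_apply x' x)))"
    and "cond3 \<equiv> maximal_monotone T \<and>
      (\<exists>h \<in> fitzpatrick_family T. \<forall>x\<^sub>0 x\<^sub>0'.
        (INF (x, x'). translate h (x\<^sub>0, x\<^sub>0') (x, x')
           + ereal (1/2 * (norm x)\<^sup>2 + 1/2 * (norm x')\<^sup>2)) = 0)"
    and "cond4 \<equiv> maximal_monotone T \<and>
      (\<forall>h \<in> fitzpatrick_family T. \<forall>x\<^sub>0 x\<^sub>0'.
        (INF (x, x'). translate h (x\<^sub>0, x\<^sub>0') (x, x')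
           + ereal (1/2 * (norm x)\<^sup>2 + 1/2 * (norm x')\<^sup>2)) = 0)"
    and "cond5 \<equiv> type_NI T"
  shows "(cond1 \<longleftrightarrow> cond2) \<and> (cond2 \<longleftrightarrow> cond3) \<and> (cond3 \<longleftrightarrow> cond4) \<and> (cond4 \<longleftrightarrow> cond5)"
proof -
  have fam: "ereal (blinfun_apply x' x) \<le> h (x, x')" if "h \<in> fitzpatrick_family T" for h x x'
    using fitzpatrick_family_ge[OF that, of "(x, x')"] by simp
  have c3: "cond3 \<longleftrightarrow> maximal_monotone T \<and> (\<exists>h\<in>fitzpatrick_family T. inf_condition h)"
    and c4: "cond4 \<longleftrightarrow> maximal_monotone T \<and> (\<forall>h\<in>fitzpatrick_family T. inf_condition h)"
    unfolding cond3_def cond4_def using inf_condition_iff[of _ T] by blast+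
  \<comment> \<open>The implications run in the cycle 1, 3, 5, 2, 1; condition 4 is joined to it by
    2, 4, 3.\<close>
  have "cond1 \<Longrightarrow> cond3" and "cond2 \<Longrightarrow> cond4"
    unfolding c3 c4 cond1_def cond2_def using conjugate_ge_imp_inf_condition[of _ T] by blast+
  moreover have "cond3 \<Longrightarrow> cond5"
    unfolding c3 cond5_def using inf_condition_imp_type_NI by blast
  moreover have "cond5 \<Longrightarrow> cond2"
    unfolding cond5_def cond2_def using type_NI_imp_conjugate_ge[of T] fam
    by (auto simp: type_NI_def)
  moreover have "cond2 \<Longrightarrow> cond1" and "cond4 \<Longrightarrow> cond3"
    unfolding c3 c4 cond1_def cond2_def using fitzpatrick_function_in_family by blast+
  ultimately show ?thesis
    by blast
qed

end
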